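(* Let $G$ be a connected graph with $\chi(G)=k\ge 3$. Suppose $\mathscr C_0$ is an extendable coloring of $G[S]$ for some $S\subset V(G)$. If there is an edge $xy$ of $G$ with $x,y\notin S$ such that $\deg(x)\le k-1$ and $\deg(y)\le k-1$, then $\mathscr C_0$ is not a Sudoku coloring of $G$.
   Context: Graphs are finite, undirected and simple. Let $G=(V,E)$ be a connected graph with chromatic number $\chi(G)=k\ge 2$. For $S\subset V$, let $\mathscr C_0$ be a proper coloring of the induced subgraph $G[S]$ with colors from $\{1,\dots,k\}$ (not all colors need be used). An extension of $\mathscr C_0$ is a proper $k$-coloring $V\to\{1,\dots,k\}$ of $G$ whose restriction to $S$ is $\mathscr C_0$. $\mathscr C_0$ is extendable if it has at least one extension, and is a Sudoku coloring of $G$ if it has exactly one extension. *)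

theory Defs
  imports "Graph_Theory.Graph_Theory" "HOL-Library.FuncSet"
begin

text \<open>
  A finite simple undirected graph is a digraph satisfying the locale predicate
  \<^const>\<open>graph\<close>: finite, loop-free, without parallel arcs, and symmetric. Each undirected
  edge is thus a pair of opposite arcs, and the degree of a vertex (the number of its
  neighbours) is its \<^const>\<open>out_degree\<close>.

  Colorings are extensional functions (\<^const>\<open>undefined\<close> outside the vertex set), so that
  equality of HOL functions is equality of colorings; this matters when colorings are counted.
\<close>

definition proper_coloring :: "('a, 'b) pre_digraph \<Rightarrow> nat \<Rightarrow> ('a \<Rightarrow> nat) \<Rightarrow> bool" where
  "proper_coloring G k c \<longleftrightarrow>
     c \<in> verts G \<rightarrow>\<^sub>E {1..k} \<and> (\<forall>u v. u \<rightarrow>\<^bsub>G\<^esub> v \<longrightarrow> c u \<noteq> c v)"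

definition chromatic_number :: "('a, 'b) pre_digraph \<Rightarrow> nat" where
  "chromatic_number G = (LEAST k. \<exists>c. proper_coloring G k c)"

definition is_extension ::
  "('a, 'b) pre_digraph \<Rightarrow> 'a set \<Rightarrow> ('a \<Rightarrow> nat) \<Rightarrow> ('a \<Rightarrow> nat) \<Rightarrow> bool" where
  "is_extension G S C0 c \<longleftrightarrow>
     proper_coloring G (chromatic_number G) c \<and> restrict c S = C0"

definition extendable :: "('a, 'b) pre_digraph \<Rightarrow> 'a set \<Rightarrow> ('a \<Rightarrow> nat) \<Rightarrow> bool" where
  "extendable G S C0 \<longleftrightarrow> (\<exists>c. is_extension G S C0 c)"

definition sudoku_coloring :: "('a, 'b) pre_digraph \<Rightarrow> 'a set \<Rightarrow> ('a \<Rightarrow> nat) \<Rightarrow> bool" where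
  "sudoku_coloring G S C0 \<longleftrightarrow> (\<exists>!c. is_extension G S C0 c)"

end

theory Submission
  imports Defs
begin

text \<open>
  If an extension \<open>c\<close> is unique, then no uncolored vertex can be recolored on its own, so every
  color but its own occurs among its neighbors. A vertex of degree at most \<open>k - 1\<close> has no two
  neighbors to spare, so its neighbors have pairwise distinct colors. When both ends of \<open>xy\<close> have
  this property, no other neighbor of \<open>x\<close> has the color of \<open>y\<close> and vice versa, and interchanging
  the colors of \<open>x\<close> and \<open>y\<close> gives a second extension.
\<close>

lemma proper_coloring_recolor:
  assumes "graph G" and c: "proper_coloring G k c" and "v \<in> verts G" and "a \<in> {1..k}"
    and free: "\<And>w. v \<rightarrow>\<^bsub>G\<^esub> w \<Longrightarrow> c w \<noteq> a"
  shows "proper_coloring G k (c(v := a))"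
proof -
  interpret graph G by fact
  have "c(v := a) \<in> verts G \<rightarrow>\<^sub>E {1..k}"
    using c assms(3,4) by (auto simp: proper_coloring_def PiE_iff extensional_def)
  moreover have "(c(v := a)) u \<noteq> (c(v := a)) w" if "u \<rightarrow>\<^bsub>G\<^esub> w" for u w
    using that c free adj_not_same graph_symmetric[OF that]
    by (auto simp: proper_coloring_def)
  ultimately show ?thesis
    by (auto simp: proper_coloring_def)
qed

text \<open>By injectivity, \<open>y\<close> is the only neighbor of \<open>x\<close> with color
  \<open>c y\<close>, so \<open>x\<close> may take that color once \<open>y\<close> gives it up;
  likewise for \<open>y\<close> and \<open>c x\<close>.\<close>

lemma proper_coloring_swap:
  assumes "graph G" and c: "proper_coloring G k c" and xy: "x \<rightarrow>\<^bsub>G\<^esub> y"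
    and x: "inj_on c {w. x \<rightarrow>\<^bsub>G\<^esub> w}" and y: "inj_on c {w. y \<rightarrow>\<^bsub>G\<^esub> w}"
  shows "proper_coloring G k (c(x := c y, y := c x))"
proof -
  interpret graph G by fact
  let ?d = "c(x := c y, y := c x)"
  have yx: "y \<rightarrow>\<^bsub>G\<^esub> x"
    using xy by (rule graph_symmetric)
  have x': "c w \<noteq> c y" if "x \<rightarrow>\<^bsub>G\<^esub> w" "w \<noteq> y" for w
    using inj_onD[OF x] that xy by blast
  have y': "c w \<noteq> c x" if "y \<rightarrow>\<^bsub>G\<^esub> w" "w \<noteq> x" for w
    using inj_onD[OF y] that yx by blast
  have "x \<in> verts G" "y \<in> verts G"
    using xy by (auto dest: adj_in_verts)
  then have "?d \<in> verts G \<rightarrow>\<^sub>E {1..k}"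
    using c by (auto simp: proper_coloring_def PiE_iff extensional_def)
  moreover have "?d u \<noteq> ?d w" if uw: "u \<rightarrow>\<^bsub>G\<^esub> w" for u w
  proof -
    have "u \<noteq> w" "c u \<noteq> c w"
      using uw adj_not_same c by (auto simp: proper_coloring_def)
    \<comment> \<open>\<open>x'\<close> and \<open>y'\<close> speak of arcs leaving \<open>x\<close>
      and \<open>y\<close>; the reversed arc covers those entering.\<close>
    then show ?thesis
      using uw graph_symmetric[OF uw] x'[of u] x'[of w] y'[of u] y'[of w] by auto
  qed
  ultimately show ?thesis
    by (auto simp: proper_coloring_def)
qed

text \<open>Pigeonhole with equality: at most \<open>k - 1\<close> neighbors carry all
  \<open>k - 1\<close> colors other than \<open>c v\<close>, so none repeats. Uniqueness of the
  extension enters as \<open>rigid\<close>.\<close>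

lemma inj_on_neighbors:
  assumes "graph G" and c: "proper_coloring G k c" and v: "v \<in> verts G"
    and deg: "out_degree G v \<le> k - 1"
    and rigid: "\<And>a. proper_coloring G k (c(v := a)) \<Longrightarrow> a = c v"
  shows "inj_on c {w. v \<rightarrow>\<^bsub>G\<^esub> w}"
proof -
  interpret graph G by fact
  let ?N = "{w. v \<rightarrow>\<^bsub>G\<^esub> w}"
  have N: "?N = head G ` out_arcs G v"
    by (auto simp: arcs_ends_conv)
  have fin: "finite ?N"
    unfolding N by (intro finite_imageI finite_out_arcs)
  have "card ?N \<le> k - 1"
    using deg card_image_le[OF finite_out_arcs, of "head G" v] unfolding N out_degree_def by simp
  also have "k - 1 = card ({1..k} - {c v})"
    using c v by (auto simp: proper_coloring_def PiE_iff)
  \<comment> \<open>A color other than \<open>c v\<close> missing from the neighbors could be given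
    to \<open>v\<close>, against \<open>rigid\<close>.\<close>
  also have "{1..k} - {c v} \<subseteq> c ` ?N"
    using proper_coloring_recolor[OF \<open>graph G\<close> c v] rigid by blast
  then have "card ({1..k} - {c v}) \<le> card (c ` ?N)"
    using fin by (intro card_mono) auto
  finally have "card (c ` ?N) = card ?N"
    using card_image_le[OF fin] by (metis le_antisym)
  then show ?thesis
    using fin by (rule eq_card_imp_inj_on[rotated])
qed

theorem lemma2p7:
  fixes G :: "('a, 'b) pre_digraph" and k :: nat
    and S :: "'a set" and C0 :: "'a \<Rightarrow> nat" and x y :: 'a
  assumes "graph G" and "connected G"
    and "chromatic_number G = k" and "k \<ge> 3"
    and "S \<subseteq> verts G"
    and "proper_coloring (G \<restriction> S) k C0"
    and "extendable G S C0"
    and "x \<rightarrow>\<^bsub>G\<^esub> y" and "x \<notin> S" and "y \<notin> S"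
    and "out_degree G x \<le> k - 1" and "out_degree G y \<le> k - 1"
  shows "\<not> sudoku_coloring G S C0"
proof
  interpret graph G by fact
  assume "sudoku_coloring G S C0"
  then obtain c where c: "is_extension G S C0 c"
    and unique: "\<And>d. is_extension G S C0 d \<Longrightarrow> d = c"
    unfolding sudoku_coloring_def by blast
  have pc: "proper_coloring G k c" and rc: "restrict c S = C0"
    using c \<open>chromatic_number G = k\<close> by (auto simp: is_extension_def)
  \<comment> \<open>Agreement with \<open>c\<close> on \<open>S\<close> makes \<open>d\<close> an
    extension of \<open>C0\<close>, so changes outside \<open>S\<close> fall under
    uniqueness.\<close>
  have eq: "d = c" if "proper_coloring G k d" "\<And>s. s \<in> S \<Longrightarrow> d s = c s" for d
    using that rc \<open>chromatic_number G = k\<close>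
    by (intro unique) (auto simp: is_extension_def cong: restrict_cong)
  have inj: "inj_on c {w. v \<rightarrow>\<^bsub>G\<^esub> w}"
    if "v \<in> verts G" "v \<notin> S" "out_degree G v \<le> k - 1" for v
  proof (rule inj_on_neighbors[OF \<open>graph G\<close> pc])
    fix a
    assume "proper_coloring G k (c(v := a))"
    then have "c(v := a) = c"
      using that by (intro eq) auto
    then show "a = c v"
      by (metis fun_upd_same)
  qed (use that in auto)
  have "x \<in> verts G" "y \<in> verts G"
    using \<open>x \<rightarrow>\<^bsub>G\<^esub> y\<close> by (auto dest: adj_in_verts)
  then have "proper_coloring G k (c(x := c y, y := c x))"
    using assms by (intro proper_coloring_swap pc inj)
  then have "c(x := c y, y := c x) = c"
    using \<open>x \<notin> S\<close> \<open>y \<notin> S\<close> by (intro eq) auto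
  \<comment> \<open>Both sides are evaluated at \<open>y\<close>; the result contradicts the edge
    \<open>xy\<close>.\<close>
  then have "c x = c y"
    by (metis fun_upd_same)
  then show False
    using pc \<open>x \<rightarrow>\<^bsub>G\<^esub> y\<close> by (auto simp: proper_coloring_def)
qed

end
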